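(* Let $\boldsymbol{n} = (n_1, \dots, n_k)$. If $(\mathcal{M}, f_1, \dots, f_k)$ is a unique factorisation normed $\boldsymbol{n}$-magma with non-empty finite set of irreducibles $\mathcal{M}^0$, then $(\mathcal{M}, f_1, \dots, f_k)$ is a free $\boldsymbol{n}$-magma generated by the irreducible elements (that is, it is free with set of generators $\mathcal{M}^0$).
   Context: $\mathbb{N} = \{1,2,3,\dots\}$ (zero excluded). For $\boldsymbol{n} = (n_1, \dots, n_k)$ a tuple of positive integers with $n_1 \le \dots \le n_k$, an $\boldsymbol{n}$-magma is a tuple $(\mathcal{M}, f_1, \dots, f_k)$ where $\mathcal{M}$ is a non-empty countable set and each $f_i : \mathcal{M}^{n_i} \to \mathcal{M}$ is an $n_i$-ary map. An $\boldsymbol{n}$-magma morphism from $(\mathcal{M}, f_1, \dots, f_k)$ to $(\mathcal{N}, g_1, \dots, g_k)$ is a map $\theta : \mathcal{M} \to \mathcal{N}$ with $\theta(f_i(m_1, \dots, m_{n_i})) = g_i(\theta(m_1), \dots, \theta(m_{n_i}))$ for all $i$ and all $m_1, \dots, m_{n_i} \in \mathcal{M}$. Write $\mathcal{M}_i^+ = \mathrm{Img}(f_i)$, $\mathcal{M}^+ = \bigcup_{i=1}^k \mathcal{M}_i^+$ and $\mathcal{M}^0 = \mathcal{M} \setminus \mathcal{M}^+$ (the set of irreducibles). The $\boldsymbol{n}$-magma is a unique factorisation $\boldsymbol{n}$-magma if every $f_i$ is injective and $\mathcal{M}_i^+ \cap \mathcal{M}_j^+ = \emptyset$ for all $i \ne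 j$. A norm is a map $\lVert\cdot\rVert : \mathcal{M} \to \mathbb{N}$ such that (1) for every unary $f_i$ and every $m \in \mathcal{M}$, $\lVert f_i(m)\rVert > \lVert m\rVert$; (2) for every $f_i$ with $n_i > 1$ and all $m_1, \dots, m_{n_i} \in \mathcal{M}$, $\lVert f_i(m_1, \dots, m_{n_i})\rVert \ge \sum_{j=1}^{n_i} \lVert m_j\rVert$. A normed $\boldsymbol{n}$-magma is one that has a norm. $(\mathcal{M}, f_1, \dots, f_k)$ is free if there exist a set $Y$ and a map $i : Y \to \mathcal{M}$ such that for every $\boldsymbol{n}$-magma $(\mathcal{N}, f_1', \dots, f_k')$ and every map $\varphi : Y \to \mathcal{N}$ there exists a unique $\boldsymbol{n}$-magma morphism $\theta : \mathcal{M} \to \mathcal{N}$ with $\varphi = \theta \circ i$. The image $i(Y) \subseteq \mathcal{M}$ is called the set of generators of $\mathcal{M}$. *)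

theory Defs
  imports "HOL-Library.Countable_Set" "HOL-Library.FuncSet" "HOL-Library.NList"
begin

text \<open>
  The arity tuple is a list \<open>ns\<close>; the operation with index \<open>i < length ns\<close> is \<open>f i\<close>, and its
  arguments are the lists in \<open>nlists (ns ! i) M\<close>, that is, the elements of the \<open>ns ! i\<close>-fold
  power of the carrier \<open>M\<close>. Indices start at 0. The values of \<open>f\<close> at other indices or on other
  lists are irrelevant.
\<close>

definition nmagma :: "nat list \<Rightarrow> 'a set \<Rightarrow> (nat \<Rightarrow> 'a list \<Rightarrow> 'a) \<Rightarrow> bool" where
  "nmagma ns M f \<longleftrightarrow>
     M \<noteq> {} \<and> countable M \<and> (\<forall>i<length ns. f i \<in> nlists (ns ! i) M \<rightarrow> M)"

definition nmagma_hom ::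
  "nat list \<Rightarrow> 'a set \<Rightarrow> (nat \<Rightarrow> 'a list \<Rightarrow> 'a) \<Rightarrow> 'b set \<Rightarrow> (nat \<Rightarrow> 'b list \<Rightarrow> 'b) \<Rightarrow> ('a \<Rightarrow> 'b) \<Rightarrow> bool"
  where
  "nmagma_hom ns M f N g \<theta> \<longleftrightarrow>
     \<theta> \<in> M \<rightarrow> N \<and>
     (\<forall>i<length ns. \<forall>ms\<in>nlists (ns ! i) M. \<theta> (f i ms) = g i (map \<theta> ms))"

definition op_image :: "nat list \<Rightarrow> 'a set \<Rightarrow> (nat \<Rightarrow> 'a list \<Rightarrow> 'a) \<Rightarrow> nat \<Rightarrow> 'a set" where
  "op_image ns M f i = f i ` nlists (ns ! i) M"

definition reducibles :: "nat list \<Rightarrow> 'a set \<Rightarrow> (nat \<Rightarrow> 'a list \<Rightarrow> 'a) \<Rightarrow> 'a set" where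
  "reducibles ns M f = (\<Union>i<length ns. op_image ns M f i)"

definition irreducibles :: "nat list \<Rightarrow> 'a set \<Rightarrow> (nat \<Rightarrow> 'a list \<Rightarrow> 'a) \<Rightarrow> 'a set" where
  "irreducibles ns M f = M - reducibles ns M f"

definition unique_factorisation :: "nat list \<Rightarrow> 'a set \<Rightarrow> (nat \<Rightarrow> 'a list \<Rightarrow> 'a) \<Rightarrow> bool" where
  "unique_factorisation ns M f \<longleftrightarrow>
     (\<forall>i<length ns. inj_on (f i) (nlists (ns ! i) M)) \<and>
     (\<forall>i<length ns. \<forall>j<length ns. i \<noteq> j \<longrightarrow> op_image ns M f i \<inter> op_image ns M f j = {})"

definition is_norm ::
  "nat list \<Rightarrow> 'a set \<Rightarrow> (nat \<Rightarrow> 'a list \<Rightarrow> 'a) \<Rightarrow> ('a \<Rightarrow> nat) \<Rightarrow> bool" where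
  "is_norm ns M f \<nu> \<longleftrightarrow>
     (\<forall>m\<in>M. 1 \<le> \<nu> m) \<and>
     (\<forall>i<length ns. ns ! i = 1 \<longrightarrow> (\<forall>m\<in>M. \<nu> (f i [m]) > \<nu> m)) \<and>
     (\<forall>i<length ns. ns ! i > 1 \<longrightarrow>
        (\<forall>ms\<in>nlists (ns ! i) M. \<nu> (f i ms) \<ge> (\<Sum>j<ns ! i. \<nu> (ms ! j))))"

definition normed :: "nat list \<Rightarrow> 'a set \<Rightarrow> (nat \<Rightarrow> 'a list \<Rightarrow> 'a) \<Rightarrow> bool" where
  "normed ns M f \<longleftrightarrow> (\<exists>\<nu>. is_norm ns M f \<nu>)"

text \<open>
  The universal property of \<open>\<iota> : Y \<rightarrow> M\<close> with respect to all magmas whose carrier is a subset of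
  the type \<open>'b\<close>. HOL cannot quantify over types inside a formula, so \<open>'b\<close> is a parameter.
  Morphisms are taken in \<open>M \<rightarrow>\<^sub>E N\<close> so that uniqueness means uniqueness as a map on \<open>M\<close>.
\<close>

definition universal_map ::
  "'b itself \<Rightarrow> nat list \<Rightarrow> 'a set \<Rightarrow> (nat \<Rightarrow> 'a list \<Rightarrow> 'a) \<Rightarrow> 'y set \<Rightarrow> ('y \<Rightarrow> 'a) \<Rightarrow> bool" where
  "universal_map T ns M f Y \<iota> \<longleftrightarrow>
     \<iota> \<in> Y \<rightarrow> M \<and>
     (\<forall>(N :: 'b set) g \<phi>. nmagma ns N g \<and> \<phi> \<in> Y \<rightarrow> N \<longrightarrow>
        (\<exists>!\<theta>. \<theta> \<in> M \<rightarrow>\<^sub>E N \<and> nmagma_hom ns M f N g \<theta> \<and> (\<forall>y\<in>Y. \<phi> y = \<theta> (\<iota> y))))"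

lemma map_in_nlists: "ms \<in> nlists n A \<Longrightarrow> h \<in> A \<rightarrow> B \<Longrightarrow> map h ms \<in> nlists n B"
  using nlistsE_set[of ms n A] by (intro nlistsI) (auto simp: Pi_iff subset_iff)

text \<open>
  Carriers are countable, so the type \<open>nat\<close> already contains a copy of every magma: a map that is
  universal for \<open>'b = nat\<close> is universal for every \<open>'b\<close>.
\<close>

lemma universal_map_nat:
  assumes "universal_map TYPE(nat) ns M f Y \<iota>" "nmagma ns M f"
  shows "universal_map TYPE('b) ns M f Y \<iota>"
  unfolding universal_map_def
proof (intro conjI allI impI)
  show i: "\<iota> \<in> Y \<rightarrow> M" using assms by (simp add: universal_map_def)
  fix N :: "'b set" and g \<phi>
  assume A: "nmagma ns N g \<and> \<phi> \<in> Y \<rightarrow> N"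
  define e where "e = to_nat_on N"
  define d where "d = inv_into N e"
  define g' where "g' = (\<lambda>i xs. e (g i (map d xs)))"
  have inj: "inj_on e N"
    using A by (auto simp: nmagma_def e_def intro: inj_on_to_nat_on)
  have de: "d (e x) = x" if "x \<in> N" for x
    using inj that by (simp add: d_def)
  have dN: "d x \<in> N" if "x \<in> e ` N" for x
    using that by (simp add: d_def inv_into_into)
  have fM: "f i ms \<in> M" if "i < length ns" "ms \<in> nlists (ns ! i) M" for i ms
    using assms(2) that by (auto simp: nmagma_def)
  have gN: "g i ms \<in> N" if "i < length ns" "ms \<in> nlists (ns ! i) N" for i ms
    using A that by (auto simp: nmagma_def)
  have "g' i ms \<in> e ` N" if "i < length ns" "ms \<in> nlists (ns ! i) (e ` N)" for i ms
  proof -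
    have "map d ms \<in> nlists (ns ! i) N"
      using that(2) by (rule map_in_nlists) (use dN in blast)
    then show ?thesis using gN[OF that(1)] by (simp add: g'_def)
  qed
  then have N': "nmagma ns (e ` N) g'"
    using A by (simp add: nmagma_def)
  have "(\<lambda>y. e (\<phi> y)) \<in> Y \<rightarrow> e ` N" using A by auto
  with assms(1)[unfolded universal_map_def, THEN conjunct2, rule_format, of "e ` N" g'] N'
  have ex: "\<exists>!\<theta>. \<theta> \<in> M \<rightarrow>\<^sub>E e ` N \<and> nmagma_hom ns M f (e ` N) g' \<theta> \<and> (\<forall>y\<in>Y. e (\<phi> y) = \<theta> (\<iota> y))"
    by blast
  then obtain \<theta> where th: "\<theta> \<in> M \<rightarrow>\<^sub>E e ` N" "nmagma_hom ns M f (e ` N) g' \<theta>"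
    "\<forall>y\<in>Y. e (\<phi> y) = \<theta> (\<iota> y)" by blast
  show "\<exists>!\<theta>. \<theta> \<in> M \<rightarrow>\<^sub>E N \<and> nmagma_hom ns M f N g \<theta> \<and> (\<forall>y\<in>Y. \<phi> y = \<theta> (\<iota> y))"
  proof (rule ex_ex1I)
    let ?t = "restrict (\<lambda>m. d (\<theta> m)) M"
    have tN: "?t \<in> M \<rightarrow>\<^sub>E N" using th(1) dN by auto
    have "?t (f i ms) = g i (map ?t ms)" if "i < length ns" "ms \<in> nlists (ns ! i) M" for i ms
    proof -
      have m: "map ?t ms = map d (map \<theta> ms)"
        using nlistsE_set[OF that(2)] by auto
      have "map ?t ms \<in> nlists (ns ! i) N"
        using that(2) by (rule map_in_nlists) (use tN in auto)
      then have "g i (map ?t ms) \<in> N" using gN that by blast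
      moreover have "\<theta> (f i ms) = e (g i (map d (map \<theta> ms)))"
        using th(2) that by (simp add: nmagma_hom_def g'_def)
      ultimately show ?thesis
        unfolding m using fM[OF that] de by simp
    qed
    moreover have "\<forall>y\<in>Y. \<phi> y = ?t (\<iota> y)"
    proof
      fix y assume y: "y \<in> Y"
      then have "\<phi> y \<in> N" "\<iota> y \<in> M" using A i by auto
      moreover have "\<theta> (\<iota> y) = e (\<phi> y)" using th(3) y by simp
      ultimately show "\<phi> y = ?t (\<iota> y)" using de by simp
    qed
    moreover have "?t \<in> M \<rightarrow> N" using tN by auto
    ultimately have "nmagma_hom ns M f N g ?t" "\<forall>y\<in>Y. \<phi> y = ?t (\<iota> y)"
      unfolding nmagma_hom_def by blast+
    with tN show "\<exists>\<theta>. \<theta> \<in> M \<rightarrow>\<^sub>E N \<and> nmagma_hom ns M f N g \<theta> \<and> (\<forall>y\<in>Y. \<phi> y = \<theta> (\<iota> y))"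
      by blast
  next
    have lift: "restrict (\<lambda>m. e (t m)) M \<in> M \<rightarrow>\<^sub>E e ` N \<and>
        nmagma_hom ns M f (e ` N) g' (restrict (\<lambda>m. e (t m)) M) \<and>
        (\<forall>y\<in>Y. e (\<phi> y) = restrict (\<lambda>m. e (t m)) M (\<iota> y))"
      if t: "t \<in> M \<rightarrow>\<^sub>E N \<and> nmagma_hom ns M f N g t \<and> (\<forall>y\<in>Y. \<phi> y = t (\<iota> y))" for t
    proof -
      let ?u = "restrict (\<lambda>m. e (t m)) M"
      have "?u (f i ms) = g' i (map ?u ms)" if "i < length ns" "ms \<in> nlists (ns ! i) M" for i ms
      proof -
        have m: "map d (map ?u ms) = map t ms"
          using nlistsE_set[OF that(2)] t de by (auto simp: subset_iff PiE_mem)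
        show ?thesis
          unfolding g'_def m using t that fM[OF that] by (simp add: nmagma_hom_def)
      qed
      moreover have "?u \<in> M \<rightarrow>\<^sub>E e ` N" "?u \<in> M \<rightarrow> e ` N" using t by auto
      moreover have "e (\<phi> y) = ?u (\<iota> y)" if "y \<in> Y" for y
        using t i that by auto
      ultimately show ?thesis unfolding nmagma_hom_def by blast
    qed
    fix t u
    assume t: "t \<in> M \<rightarrow>\<^sub>E N \<and> nmagma_hom ns M f N g t \<and> (\<forall>y\<in>Y. \<phi> y = t (\<iota> y))"
      and u: "u \<in> M \<rightarrow>\<^sub>E N \<and> nmagma_hom ns M f N g u \<and> (\<forall>y\<in>Y. \<phi> y = u (\<iota> y))"
    have eq: "restrict (\<lambda>m. e (t m)) M = restrict (\<lambda>m. e (u m)) M"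
      using ex lift[OF t] lift[OF u] by blast
    show "t = u"
    proof (rule PiE_ext[of _ M "\<lambda>_. N"])
      fix m assume m: "m \<in> M"
      have "e (t m) = e (u m)" using fun_cong[OF eq, of m] m by simp
      then show "t m = u m" using inj t u m by (auto simp: inj_on_def)
    qed (use t u in auto)
  qed
qed

text \<open>
  \<open>free_nmagma T ns M f G\<close>: the magma is free with set of generators \<open>G\<close>. Looking for \<open>Y\<close> inside
  the type \<open>'a\<close> of the carrier loses nothing: a universal \<open>\<iota>\<close> is injective (map into a magma with
  two elements), so \<open>Y\<close> can be replaced by a copy of \<open>Y\<close> in \<open>M\<close>.
\<close>

definition free_nmagma ::
  "'b itself \<Rightarrow> nat list \<Rightarrow> 'a set \<Rightarrow> (nat \<Rightarrow> 'a list \<Rightarrow> 'a) \<Rightarrow> 'a set \<Rightarrow> bool" where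
  "free_nmagma T ns M f G \<longleftrightarrow>
     nmagma ns M f \<and> (\<exists>(Y :: 'a set) \<iota>. universal_map T ns M f Y \<iota> \<and> \<iota> ` Y = G)"

text \<open>
  The instance \<open>'b = nat\<close> is the full notion of freeness: \<open>Y\<close> and \<open>\<iota>\<close> are chosen before the
  test magma \<open>N\<close> and are universal for \<open>N\<close> in every type.
\<close>

lemma free_nmagma_nat:
  assumes "free_nmagma TYPE(nat) ns M f G"
  shows "free_nmagma TYPE('b) ns M f G"
  using assms universal_map_nat[where 'b = 'b] unfolding free_nmagma_def by blast

end

theory Submission
  imports Defs
begin

text \<open>
  Every argument of an operation has strictly smaller norm than the value: for a unary operation
  this is part of the definition of a norm, and otherwise the value dominates the sum over at least
  two arguments, each of norm at least 1. Repeatedly splitting an element into arguments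
  therefore stops, and it can only stop at irreducibles. This yields an induction principle over
  the construction of elements (\<open>magma_induct\<close>), from which uniqueness of morphisms with prescribed
  values on the irreducibles is immediate (\<open>hom_eqI\<close>).

  For existence, the extension of a map \<open>\<phi>\<close> on the irreducibles is first described as a relation,
  the least one that contains \<open>\<phi>\<close> and is closed under the operations. Unique factorisation says
  that each element enters this relation by exactly one rule, applied to exactly one argument list,
  so by induction the relation is the graph of a map (\<open>ext_graph_iff_hom_ext\<close>), and closure under
  the operations says that this map is a morphism (\<open>hom_extension_exists\<close>).
\<close>

lemma nmagma_closed:
  "nmagma ns M f \<Longrightarrow> i < length ns \<Longrightarrow> ms \<in> nlists (ns ! i) M \<Longrightarrow> f i ms \<in> M"
  by (auto simp: nmagma_def)

lemma norm_argument_less: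
  assumes norm: "is_norm ns M f \<nu>" and pos: "\<forall>n\<in>set ns. 0 < n"
    and i: "i < length ns" and ms: "ms \<in> nlists (ns ! i) M" and m: "m \<in> set ms"
  shows "\<nu> m < \<nu> (f i ms)"
proof -
  have len: "length ms = ns ! i" and sub: "set ms \<subseteq> M"
    using ms by auto
  show ?thesis
  proof (cases "ns ! i = 1")
    case True
    then have "ms = [m]"
      using len m by (cases ms) auto
    then show ?thesis
      using norm i m sub True by (auto simp: is_norm_def)
  next
    case False
    with pos i have gt: "ns ! i > 1"
      by (metis One_nat_def Suc_lessI nth_mem)
    obtain j where j: "j < ns ! i" "m = ms ! j"
      using m len by (auto simp: in_set_conv_nth)
    \<comment> \<open>A second argument position, whose norm of at least 1 makes the inequality strict.\<close>
    obtain l where l: "l < ns ! i" "l \<noteq> j"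
      using gt that[of "if j = 0 then 1 else 0"] by auto
    have "ms ! l \<in> M"
      using l len sub by auto
    then have "1 \<le> \<nu> (ms ! l)"
      using norm by (simp add: is_norm_def)
    then have "\<nu> m < (\<Sum>k\<in>{j, l}. \<nu> (ms ! k))"
      using j l by simp
    also have "\<dots> \<le> (\<Sum>k<ns ! i. \<nu> (ms ! k))"
      using j l by (intro sum_mono2) auto
    also have "\<dots> \<le> \<nu> (f i ms)"
      using norm i gt ms by (simp add: is_norm_def)
    finally show ?thesis .
  qed
qed

text \<open>
  Induction on the norm: a reducible element splits into arguments of smaller norm. The element is
  thereby treated like a term whose variables are irreducibles.
\<close>

lemma magma_induct [consumes 3, case_names irreducible operation]:
  assumes "normed ns M f" and pos: "\<forall>n\<in>set ns. 0 < n" and "m \<in> M"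
    and irr: "\<And>m. m \<in> irreducibles ns M f \<Longrightarrow> P m"
    and op: "\<And>i ms. i < length ns \<Longrightarrow> ms \<in> nlists (ns ! i) M \<Longrightarrow>
               (\<And>m. m \<in> set ms \<Longrightarrow> P m) \<Longrightarrow> P (f i ms)"
  shows "P m"
proof -
  obtain \<nu> where norm: "is_norm ns M f \<nu>"
    using assms(1) by (auto simp: normed_def)
  from \<open>m \<in> M\<close> show ?thesis
  proof (induction m rule: measure_induct_rule[of \<nu>])
    case (less m)
    show ?case
    proof (cases "m \<in> irreducibles ns M f")
      case False
      with \<open>m \<in> M\<close> obtain i ms where fact: "i < length ns" "ms \<in> nlists (ns ! i) M" "m = f i ms"
        by (auto simp: irreducibles_def reducibles_def op_image_def)
      have "P x" if "x \<in> set ms" for x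
        using that fact less.IH norm_argument_less[OF norm pos] nlistsE_set[OF fact(2)] by blast
      then show ?thesis
        using op fact by blast
    qed (rule irr)
  qed
qed

lemma hom_eqI:
  assumes "normed ns M f" and "\<forall>n\<in>set ns. 0 < n"
    and hom: "nmagma_hom ns M f N g s" "nmagma_hom ns M f N g t"
    and eq: "\<And>y. y \<in> irreducibles ns M f \<Longrightarrow> s y = t y"
    and "m \<in> M"
  shows "s m = t m"
  using assms(1,2,6)
proof (induction m rule: magma_induct)
  case (operation i ms)
  then have "map s ms = map t ms"
    by simp
  then show ?case
    using hom operation(1,2) unfolding nmagma_hom_def by metis
qed (rule eq)

text \<open>
  The graph of the extension of \<open>\<phi>\<close> from the irreducibles. A relation is used because the value
  at a reducible element is defined through a factorisation of it; in this form, unique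
  factorisation of elements is what makes the relation single-valued.
\<close>

inductive ext_graph ::
  "nat list \<Rightarrow> 'a set \<Rightarrow> (nat \<Rightarrow> 'a list \<Rightarrow> 'a) \<Rightarrow> (nat \<Rightarrow> 'b list \<Rightarrow> 'b) \<Rightarrow> ('a \<Rightarrow> 'b) \<Rightarrow> 'a \<Rightarrow> 'b \<Rightarrow> bool"
  for ns M f g \<phi> where
  irreducible: "m \<in> irreducibles ns M f \<Longrightarrow> ext_graph ns M f g \<phi> m (\<phi> m)"
| operation: "i < length ns \<Longrightarrow> ms \<in> nlists (ns ! i) M \<Longrightarrow>
    list_all2 (ext_graph ns M f g \<phi>) ms xs \<Longrightarrow> ext_graph ns M f g \<phi> (f i ms) (g i xs)"

lemma operation_not_irreducible:
  "i < length ns \<Longrightarrow> ms \<in> nlists (ns ! i) M \<Longrightarrow> f i ms \<notin> irreducibles ns M f"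
  by (auto simp: irreducibles_def reducibles_def op_image_def)

lemma ext_graph_irreducible_iff:
  assumes "m \<in> irreducibles ns M f"
  shows "ext_graph ns M f g \<phi> m x \<longleftrightarrow> x = \<phi> m"
  using assms operation_not_irreducible[of _ ns _ M f]
  by (auto elim: ext_graph.cases intro: ext_graph.irreducible)

lemma factorisation_unique:
  assumes uf: "unique_factorisation ns M f"
    and i: "i < length ns" "ms \<in> nlists (ns ! i) M"
    and j: "j < length ns" "ks \<in> nlists (ns ! j) M"
    and eq: "f i ms = f j ks"
  shows "i = j \<and> ms = ks"
proof -
  have "f i ms \<in> op_image ns M f i \<inter> op_image ns M f j"
    unfolding op_image_def using imageI[OF i(2), of "f i"] imageI[OF j(2), of "f j"] eq by simp
  then have "i = j"
    using uf i j unfolding unique_factorisation_def by blast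
  then show ?thesis
    using uf i j eq unfolding unique_factorisation_def by (auto dest: inj_onD)
qed

text \<open>
  Rule inversion only says that a value at \<open>f i ms\<close> comes from some factorisation of that element;
  unique factorisation makes it the given one, so that the induction hypothesis for \<open>ms\<close> applies.
\<close>

lemma ext_graph_operation_iff:
  assumes uf: "unique_factorisation ns M f"
    and i: "i < length ns" and ms: "ms \<in> nlists (ns ! i) M"
  shows "ext_graph ns M f g \<phi> (f i ms) x \<longleftrightarrow>
           (\<exists>xs. list_all2 (ext_graph ns M f g \<phi>) ms xs \<and> x = g i xs)"
proof
  assume "ext_graph ns M f g \<phi> (f i ms) x"
  then show "\<exists>xs. list_all2 (ext_graph ns M f g \<phi>) ms xs \<and> x = g i xs"
  proof cases
    case irreducible
    then show ?thesis
      using operation_not_irreducible[OF i ms] by simp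
  next
    case (operation j ks xs)
    then show ?thesis
      using factorisation_unique[OF uf i ms operation(3,4,1)] by auto
  qed
qed (use i ms in \<open>auto intro: ext_graph.operation\<close>)

lemma list_all2_graph_iff:
  assumes "\<And>m x. m \<in> set ms \<Longrightarrow> R m x \<longleftrightarrow> x = h m"
  shows "list_all2 R ms xs \<longleftrightarrow> xs = map h ms"
  using assms by (induction ms arbitrary: xs) (auto simp: list_all2_Cons1)

definition hom_ext ::
  "nat list \<Rightarrow> 'a set \<Rightarrow> (nat \<Rightarrow> 'a list \<Rightarrow> 'a) \<Rightarrow> (nat \<Rightarrow> 'b list \<Rightarrow> 'b) \<Rightarrow> ('a \<Rightarrow> 'b) \<Rightarrow> 'a \<Rightarrow> 'b"
  where "hom_ext ns M f g \<phi> m = (THE x. ext_graph ns M f g \<phi> m x)"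

text \<open>
  Totality and functionality are proved together: the single value at \<open>f i ms\<close> is \<open>g i\<close> of the
  single values at the arguments.
\<close>

lemma ext_graph_iff_hom_ext:
  assumes "normed ns M f" and "\<forall>n\<in>set ns. 0 < n" and uf: "unique_factorisation ns M f"
    and "m \<in> M"
  shows "ext_graph ns M f g \<phi> m x \<longleftrightarrow> x = hom_ext ns M f g \<phi> m"
  using assms(1,2,4)
proof (induction m arbitrary: x rule: magma_induct)
  case (irreducible m)
  then show ?case
    by (simp add: hom_ext_def ext_graph_irreducible_iff)
next
  case (operation i ms)
  let ?v = "g i (map (hom_ext ns M f g \<phi>) ms)"
  have "list_all2 (ext_graph ns M f g \<phi>) ms xs \<longleftrightarrow> xs = map (hom_ext ns M f g \<phi>) ms" for xs
    by (intro list_all2_graph_iff operation(3))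
  then have "ext_graph ns M f g \<phi> (f i ms) = (\<lambda>y. y = ?v)"
    by (simp add: fun_eq_iff ext_graph_operation_iff[OF uf operation(1,2)])
  then show ?case
    unfolding hom_ext_def[of ns M f g \<phi> "f i ms"] by simp
qed

lemma hom_extension_exists:
  assumes "nmagma ns M f" and normed: "normed ns M f" and pos: "\<forall>n\<in>set ns. 0 < n"
    and uf: "unique_factorisation ns M f"
    and N: "nmagma ns N g" and \<phi>: "\<phi> \<in> irreducibles ns M f \<rightarrow> N"
  obtains \<theta> where "\<theta> \<in> M \<rightarrow>\<^sub>E N" "nmagma_hom ns M f N g \<theta>"
    "\<And>y. y \<in> irreducibles ns M f \<Longrightarrow> \<theta> y = \<phi> y"
proof -
  let ?h = "hom_ext ns M f g \<phi>"
  have graph: "ext_graph ns M f g \<phi> m x \<longleftrightarrow> x = ?h m" if "m \<in> M" for m x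
    using normed pos uf that by (rule ext_graph_iff_hom_ext)
  have h_irr: "?h y = \<phi> y" if "y \<in> irreducibles ns M f" for y
    using that by (simp add: hom_ext_def ext_graph_irreducible_iff)
  have h_op: "?h (f i ms) = g i (map ?h ms)"
    if "i < length ns" "ms \<in> nlists (ns ! i) M" for i ms
  proof -
    have "list_all2 (ext_graph ns M f g \<phi>) ms (map ?h ms)"
      using nlistsE_set[OF that(2)] graph by (subst list_all2_graph_iff[where h = ?h]) auto
    then have "ext_graph ns M f g \<phi> (f i ms) (g i (map ?h ms))"
      using that by (intro ext_graph.operation)
    then show ?thesis
      using graph nmagma_closed[OF assms(1) that] by simp
  qed
  have hN: "?h m \<in> N" if "m \<in> M" for m
    using normed pos that
  proof (induction m rule: magma_induct)
    case (irreducible m)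
    then show ?case
      using \<phi> h_irr by auto
  next
    case (operation i ms)
    then have "map ?h ms \<in> nlists (ns ! i) N"
      by (intro nlistsI) auto
    then show ?case
      using operation(1,2) h_op nmagma_closed[OF N] by simp
  qed
  \<comment> \<open>The universal property compares maps that are undefined outside \<open>M\<close>.\<close>
  let ?\<theta> = "restrict ?h M"
  have "?\<theta> (f i ms) = g i (map ?\<theta> ms)" if "i < length ns" "ms \<in> nlists (ns ! i) M" for i ms
  proof -
    have "map ?\<theta> ms = map ?h ms"
      using nlistsE_set[OF that(2)] by auto
    then show ?thesis
      using h_op[OF that] nmagma_closed[OF assms(1) that] by (simp del: map_eq_conv)
  qed
  then have "nmagma_hom ns M f N g ?\<theta>"
    using hN by (simp add: nmagma_hom_def)
  moreover have "?\<theta> y = \<phi> y" if "y \<in> irreducibles ns M f" for y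
    using that h_irr by (simp add: irreducibles_def)
  ultimately show thesis
    using that[of ?\<theta>] hN by simp
qed

theorem theorem1:
  fixes ns :: "nat list" and M :: "'a set" and f :: "nat \<Rightarrow> 'a list \<Rightarrow> 'a"
  assumes "sorted ns" and "\<forall>n\<in>set ns. 0 < n"
    and "nmagma ns M f"
    and "unique_factorisation ns M f"
    and "normed ns M f"
    and "irreducibles ns M f \<noteq> {}" and "finite (irreducibles ns M f)"
  shows "free_nmagma TYPE('b) ns M f (irreducibles ns M f)"
proof -
  let ?I = "irreducibles ns M f"
  have "\<exists>!\<theta>. \<theta> \<in> M \<rightarrow>\<^sub>E N \<and> nmagma_hom ns M f N g \<theta> \<and> (\<forall>y\<in>?I. \<phi> y = \<theta> y)"
    if N: "nmagma ns N g" and \<phi>: "\<phi> \<in> ?I \<rightarrow> N" for N :: "'b set" and g \<phi>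
  proof (rule ex_ex1I)
    obtain \<theta> where "\<theta> \<in> M \<rightarrow>\<^sub>E N" "nmagma_hom ns M f N g \<theta>" "\<And>y. y \<in> ?I \<Longrightarrow> \<theta> y = \<phi> y"
      using hom_extension_exists[OF assms(3,5,2,4) N \<phi>] by blast
    then show "\<exists>\<theta>. \<theta> \<in> M \<rightarrow>\<^sub>E N \<and> nmagma_hom ns M f N g \<theta> \<and> (\<forall>y\<in>?I. \<phi> y = \<theta> y)"
      by auto
  next
    fix s t
    assume s: "s \<in> M \<rightarrow>\<^sub>E N \<and> nmagma_hom ns M f N g s \<and> (\<forall>y\<in>?I. \<phi> y = s y)"
      and t: "t \<in> M \<rightarrow>\<^sub>E N \<and> nmagma_hom ns M f N g t \<and> (\<forall>y\<in>?I. \<phi> y = t y)"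
    show "s = t"
    proof (rule PiE_ext[of _ M "\<lambda>_. N"])
      show "s m = t m" if "m \<in> M" for m
        using hom_eqI[OF assms(5,2) _ _ _ that] s t by metis
    qed (use s t in auto)
  qed
  then have "universal_map TYPE('b) ns M f ?I (\<lambda>y. y)"
    unfolding universal_map_def by (auto simp: irreducibles_def)
  then show ?thesis
    unfolding free_nmagma_def using assms(3) by (metis image_ident)
qed

end
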